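(* If $G_1\le G_2$ are (countable) directed graphs with no sinks and $n$ directed edges, then for every polynomial $p$ in $n$ noncommuting variables $$\|p\|_{G_1,\infty}\le\|p\|_{G_2,\infty}\le\|p\|_{C_n,\infty}.$$
   Context: For a countable directed graph $G$ with edge set $E(G)$ and vertex set $V(G)$, $s(e)$ and $r(e)$ denote the source and range vertices of an edge $e$; $G$ has no sinks if every vertex is the source of some edge. The number $n$ of edges satisfies $1\le n\le\infty$ (countable). Partial order: $G_1\le G_2$ means that $G_2$ is a deformation of $G_1$, i.e. $G_2$ is obtained from $G_1$ by identifying certain vertices of $G_1$; the edges of $G_2$ are thereby identified with the edges of $G_1$, and this common set of $n$ edges is given one fixed ordering. $C_n$ is the directed graph with a single vertex and $n$ loop edges. $\mathbb{F}^+(G)$ is the set of all vertices and all finite paths $w=e_k\cdots e_1$ of $G$ (with $s(e_{i+1})=r(e_i)$, $s(w)=s(e_1)$, $r(w)=r(e_k)$, and $s(x)=r(x)=x$ for vertices). $\mathcal{H}_G$ is the Hilbert space with orthonormal basis $\{\xi_w : w\in\mathbb{F}^+(G)\}$, and $L_e\xi_w=\xi_{ew}$ if $r(w)=s(e)$, $L_e\xi_w=0$ otherwise. $L_G=(L_e)_{e\in E(G)}$. For a polynomial $p$ in $n$ noncommuting variables, $p(L_G)$ is the evaluation of $p$ at the $n$ operators $L_e$ (in the fixed ordering of the edges; constant terms are evaluated as multiples of the identity), and $\|p\|_{G,\infty}:=\|p(L_G)\|$. In particular $\|p\|_{C_n,\infty}$ is the norm of $p$ evaluated at the $n$ left creation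 isometries on the full Fock space in $n$ variables. *)

theory Defs
  imports
    "HOL-Analysis.Analysis"
    "HOL-Library.Extended_Nat"
    "HOL-Library.Poly_Mapping"
    "Graph_Theory.Digraph"
begin

text \<open>The source and range of an edge are its tail and head in the library's terminology.\<close>

definition countable_digraph :: "('v, 'e) pre_digraph \<Rightarrow> bool" where
  "countable_digraph G \<longleftrightarrow> wf_digraph G \<and> countable (verts G) \<and> countable (arcs G)"

definition no_sinks :: "('v, 'e) pre_digraph \<Rightarrow> bool" where
  "no_sinks G \<longleftrightarrow> (\<forall>v\<in>verts G. \<exists>e\<in>arcs G. tail G e = v)"

text \<open>The map \<open>\<phi>\<close> sends a vertex to the vertex it becomes after the identification.
  The two graphs share their set of edges, so an enumeration of the edges of one of them
  is an enumeration of the edges of the other.\<close>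

definition deformation_le :: "('v, 'e) pre_digraph \<Rightarrow> ('w, 'e) pre_digraph \<Rightarrow> bool" where
  "deformation_le G1 G2 \<longleftrightarrow> arcs G2 = arcs G1 \<and>
     (\<exists>\<phi>. \<phi> ` verts G1 = verts G2 \<and>
          (\<forall>e\<in>arcs G1. tail G2 e = \<phi> (tail G1 e) \<and> head G2 e = \<phi> (head G1 e)))"

definition loop_digraph :: "enat \<Rightarrow> (unit, nat) pre_digraph" where
  "loop_digraph n = \<lparr>verts = UNIV, arcs = {i. enat i < n}, tail = (\<lambda>_. ()), head = (\<lambda>_. ())\<rparr>"

text \<open>The path \<open>e\<^sub>k \<cdots> e\<^sub>1\<close> is the pair of its source vertex and the list
  \<open>[e\<^sub>k, \<dots>, e\<^sub>1]\<close>; the vertex \<open>v\<close> is the pair \<open>(v, [])\<close>. Recording the source also for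
  nonempty lists, where it is determined by \<open>e\<^sub>1\<close>, keeps the empty paths at distinct
  vertices apart.\<close>

type_synonym ('v, 'e) path = "'v \<times> 'e list"

definition path_source :: "('v, 'e) path \<Rightarrow> 'v" where
  "path_source w = fst w"

definition path_range :: "('v, 'e) pre_digraph \<Rightarrow> ('v, 'e) path \<Rightarrow> 'v" where
  "path_range G w = (case snd w of [] \<Rightarrow> fst w | e # es \<Rightarrow> head G e)"

definition path_cons :: "'e \<Rightarrow> ('v, 'e) path \<Rightarrow> ('v, 'e) path" where
  "path_cons e w = (path_source w, e # snd w)"

inductive_set finite_paths :: "('v, 'e) pre_digraph \<Rightarrow> ('v, 'e) path set"
  for G :: "('v, 'e) pre_digraph" where
  vertex: "v \<in> verts G \<Longrightarrow> (v, []) \<in> finite_paths G"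
| edge: "w \<in> finite_paths G \<Longrightarrow> e \<in> arcs G \<Longrightarrow> tail G e = path_range G w
    \<Longrightarrow> path_cons e w \<in> finite_paths G"

text \<open>The Hilbert space with an orthonormal basis indexed by \<open>I\<close> is realised as
  \<open>\<ell>\<^sup>2(I)\<close>, whose elements are functions on the ambient type that vanish off \<open>I\<close>;
  \<open>ket w\<close> is the basis vector \<open>\<xi>\<^sub>w\<close>.\<close>

definition ell2 :: "'i set \<Rightarrow> ('i \<Rightarrow> complex) set" where
  "ell2 I = {f. (\<forall>i. i \<notin> I \<longrightarrow> f i = 0) \<and> (\<lambda>i. (cmod (f i))\<^sup>2) summable_on I}"

definition ell2_norm :: "'i set \<Rightarrow> ('i \<Rightarrow> complex) \<Rightarrow> real" where
  "ell2_norm I f = sqrt (\<Sum>\<^sub>\<infinity>i\<in>I. (cmod (f i))\<^sup>2)"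

definition op_norm :: "'i set \<Rightarrow> (('i \<Rightarrow> complex) \<Rightarrow> ('i \<Rightarrow> complex)) \<Rightarrow> real" where
  "op_norm I T = (SUP f\<in>{f \<in> ell2 I. ell2_norm I f \<le> 1}. ell2_norm I (T f))"

definition ket :: "'i \<Rightarrow> 'i \<Rightarrow> complex" where
  "ket w = (\<lambda>u. if u = w then 1 else 0)"

text \<open>The coefficient of \<open>L\<^sub>e f\<close> at \<open>ew\<close> is that of \<open>f\<close> at \<open>w\<close>, and the coefficients at
  all other paths are zero; see \<open>creation_ket\<close> for the action on the basis.\<close>

definition creation ::
  "('v, 'e) pre_digraph \<Rightarrow> 'e \<Rightarrow> (('v, 'e) path \<Rightarrow> complex) \<Rightarrow> (('v, 'e) path \<Rightarrow> complex)" where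
  "creation G e f = (\<lambda>u. case snd u of
       [] \<Rightarrow> 0
     | e' # es \<Rightarrow> if e' = e \<and> u \<in> finite_paths G then f (path_source u, es) else 0)"

text \<open>A polynomial in the noncommuting variables \<open>x\<^sub>i\<close>, \<open>i < n\<close>, is a finitely supported
  family of coefficients indexed by words; the word \<open>[i\<^sub>1, \<dots>, i\<^sub>k]\<close> stands for the
  monomial \<open>x\<^bsub>i\<^sub>1\<^esub> \<cdots> x\<^bsub>i\<^sub>k\<^esub>\<close>, and the empty word for the constant monomial.\<close>

definition nc_polynomials :: "enat \<Rightarrow> (nat list \<Rightarrow>\<^sub>0 complex) set" where
  "nc_polynomials n = {p. \<forall>w\<in>Poly_Mapping.keys p. \<forall>i\<in>set w. enat i < n}"

definition nc_eval :: "(nat list \<Rightarrow>\<^sub>0 complex) \<Rightarrow>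
    (nat \<Rightarrow> ('i \<Rightarrow> complex) \<Rightarrow> ('i \<Rightarrow> complex)) \<Rightarrow> ('i \<Rightarrow> complex) \<Rightarrow> ('i \<Rightarrow> complex)" where
  "nc_eval p T f = (\<lambda>u. \<Sum>w\<in>Poly_Mapping.keys p. Poly_Mapping.lookup p w * foldr T w f u)"

text \<open>The enumeration \<open>ed\<close> of the edges determines which operator is substituted for
  which variable.\<close>

definition poly_norm :: "('v, 'e) pre_digraph \<Rightarrow> (nat \<Rightarrow> 'e) \<Rightarrow> (nat list \<Rightarrow>\<^sub>0 complex) \<Rightarrow> real" where
  "poly_norm G ed p = op_norm (finite_paths G) (nc_eval p (\<lambda>i. creation G (ed i)))"

lemma finite_paths_path_cons_iff:
  "path_cons e w \<in> finite_paths G \<longleftrightarrow>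
     w \<in> finite_paths G \<and> e \<in> arcs G \<and> tail G e = path_range G w"
proof
  assume "path_cons e w \<in> finite_paths G"
  then show "w \<in> finite_paths G \<and> e \<in> arcs G \<and> tail G e = path_range G w"
    by cases (auto simp: path_cons_def path_source_def prod_eq_iff)
qed (auto intro: finite_paths.edge)

lemma creation_ket:
  assumes "e \<in> arcs G" and "w \<in> finite_paths G"
  shows "creation G e (ket w) =
    (if path_range G w = tail G e then ket (path_cons e w) else (\<lambda>_. 0))"
proof
  fix u
  show "creation G e (ket w) u =
    (if path_range G w = tail G e then ket (path_cons e w) else (\<lambda>_. 0)) u"
  proof (cases "snd u")
    case Nil
    then show ?thesis by (auto simp: creation_def ket_def path_cons_def)
  next
    case (Cons e' es)
    then obtain v where u: "u = (v, e' # es)" by (cases u) auto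
    obtain x xs where w: "w = (x, xs)" by (cases w)
    show ?thesis
      using finite_paths_path_cons_iff[of e w G] assms
      by (auto simp: u w creation_def ket_def path_cons_def path_source_def)
  qed
qed

lemma creation_bounded:
  assumes "f \<in> ell2 (finite_paths G)"
  shows "creation G e f \<in> ell2 (finite_paths G)"
    and "ell2_norm (finite_paths G) (creation G e f) \<le> ell2_norm (finite_paths G) f"
proof -
  let ?P = "finite_paths G"
  let ?A = "{w \<in> ?P. path_cons e w \<in> ?P}"
  let ?g = "\<lambda>u. (cmod (creation G e f u))\<^sup>2"
  have inj: "inj_on (path_cons e) ?A"
    by (auto simp: inj_on_def path_cons_def path_source_def)
  have g: "?g \<circ> path_cons e = (\<lambda>w. if path_cons e w \<in> ?P then (cmod (f w))\<^sup>2 else 0)"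
    by (auto simp: creation_def path_cons_def path_source_def)
  have zero: "creation G e f u = 0" if "u \<notin> path_cons e ` ?A" for u
  proof (rule ccontr)
    assume nz: "creation G e f u \<noteq> 0"
    then obtain es where es: "snd u = e # es" "u \<in> ?P"
      by (auto simp: creation_def split: list.splits if_splits)
    then have "u = path_cons e (path_source u, es)"
      by (simp add: path_cons_def path_source_def prod_eq_iff)
    with es that show False
      using finite_paths_path_cons_iff by (metis (no_types, lifting) image_eqI mem_Collect_eq)
  qed
  have sf: "(\<lambda>i. (cmod (f i))\<^sup>2) summable_on ?P"
    using assms by (simp add: ell2_def)
  have sfA: "(\<lambda>i. (cmod (f i))\<^sup>2) summable_on ?A"
    using sf by (rule summable_on_subset_banach) auto
  have "(?g \<circ> path_cons e) summable_on ?A \<longleftrightarrow> (\<lambda>i. (cmod (f i))\<^sup>2) summable_on ?A"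
    by (rule summable_on_cong) (simp add: g)
  then have "?g summable_on (path_cons e ` ?A)"
    using sfA by (simp add: summable_on_reindex[OF inj])
  moreover have "?g summable_on (path_cons e ` ?A) \<longleftrightarrow> ?g summable_on ?P"
    by (rule summable_on_cong_neutral) (use zero in auto)
  ultimately have sg: "?g summable_on ?P" by simp
  show "creation G e f \<in> ell2 ?P"
    using sg by (auto simp: ell2_def creation_def split: list.splits)
  have "infsum ?g ?P = infsum ?g (path_cons e ` ?A)"
    by (rule infsum_cong_neutral) (use zero in auto)
  also have "\<dots> = infsum (?g \<circ> path_cons e) ?A"
    by (rule infsum_reindex[OF inj])
  also have "\<dots> = (\<Sum>\<^sub>\<infinity>i\<in>?A. (cmod (f i))\<^sup>2)"
    by (rule infsum_cong) (simp add: g)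
  also have "\<dots> \<le> (\<Sum>\<^sub>\<infinity>i\<in>?P. (cmod (f i))\<^sup>2)"
    by (rule infsum_mono2[OF sfA sf]) auto
  finally show "ell2_norm ?P (creation G e f) \<le> ell2_norm ?P f"
    by (simp add: ell2_norm_def)
qed

lemma ell2_lincomb_bounded:
  assumes "f \<in> ell2 I" and "g \<in> ell2 I"
  shows "(\<lambda>i. c * f i + g i) \<in> ell2 I"
    and "(ell2_norm I (\<lambda>i. c * f i + g i))\<^sup>2
           \<le> 2 * (cmod c)\<^sup>2 * (ell2_norm I f)\<^sup>2 + 2 * (ell2_norm I g)\<^sup>2"
proof -
  let ?b = "\<lambda>i. 2 * (cmod c)\<^sup>2 * (cmod (f i))\<^sup>2 + 2 * (cmod (g i))\<^sup>2"
  have le: "(cmod (c * f i + g i))\<^sup>2 \<le> ?b i" for i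
  proof -
    have "(cmod (c * f i + g i))\<^sup>2 \<le> (cmod c * cmod (f i) + cmod (g i))\<^sup>2"
      by (rule power_mono) (auto intro: order_trans[OF norm_triangle_ineq] simp: norm_mult)
    also have "\<dots> \<le> 2 * (cmod c * cmod (f i))\<^sup>2 + 2 * (cmod (g i))\<^sup>2"
      using sum_squares_bound[of "cmod c * cmod (f i)" "cmod (g i)"]
      by (simp add: power2_sum)
    finally show ?thesis by (simp add: power_mult_distrib)
  qed
  have sf: "(\<lambda>i. 2 * (cmod c)\<^sup>2 * (cmod (f i))\<^sup>2) summable_on I"
    and sg: "(\<lambda>i. 2 * (cmod (g i))\<^sup>2) summable_on I"
    using assms by (auto simp: ell2_def intro!: summable_on_cmult_right)
  have sb: "?b summable_on I" by (rule summable_on_add[OF sf sg])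
  have sh: "(\<lambda>i. (cmod (c * f i + g i))\<^sup>2) summable_on I"
    by (rule summable_on_comparison_test[OF sb]) (use le in auto)
  then show "(\<lambda>i. c * f i + g i) \<in> ell2 I" using assms by (auto simp: ell2_def)
  have "(\<Sum>\<^sub>\<infinity>i\<in>I. (cmod (c * f i + g i))\<^sup>2) \<le> infsum ?b I"
    by (rule infsum_mono[OF sh sb]) (rule le)
  also have "\<dots> = 2 * (cmod c)\<^sup>2 * (\<Sum>\<^sub>\<infinity>i\<in>I. (cmod (f i))\<^sup>2) + 2 * (\<Sum>\<^sub>\<infinity>i\<in>I. (cmod (g i))\<^sup>2)"
    by (simp add: infsum_add[OF sf sg] infsum_cmult_right')
  finally show "(ell2_norm I (\<lambda>i. c * f i + g i))\<^sup>2
      \<le> 2 * (cmod c)\<^sup>2 * (ell2_norm I f)\<^sup>2 + 2 * (ell2_norm I g)\<^sup>2"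
    by (simp add: ell2_norm_def infsum_nonneg)
qed

lemma foldr_creation_bounded:
  assumes "f \<in> ell2 (finite_paths G)"
  shows "foldr (\<lambda>i. creation G (ed i)) w f \<in> ell2 (finite_paths G) \<and>
    ell2_norm (finite_paths G) (foldr (\<lambda>i. creation G (ed i)) w f) \<le> ell2_norm (finite_paths G) f"
  using assms by (induction w) (auto intro: creation_bounded order_trans)

text \<open>The supremum in \<open>poly_norm\<close> is one of a set that is bounded above, as is required
  for a supremum of real numbers to be meaningful.\<close>

lemma poly_norm_bdd_above:
  "bdd_above ((\<lambda>f. ell2_norm (finite_paths G) (nc_eval p (\<lambda>i. creation G (ed i)) f)) `
     {f \<in> ell2 (finite_paths G). ell2_norm (finite_paths G) f \<le> 1})"
proof -
  let ?P = "finite_paths G"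
  let ?T = "\<lambda>i. creation G (ed i)"
  let ?S = "\<lambda>W f u. \<Sum>w\<in>W. Poly_Mapping.lookup p w * foldr ?T w f u"
  have "\<exists>B. \<forall>f \<in> ell2 ?P. ell2_norm ?P f \<le> 1 \<longrightarrow>
          ?S W f \<in> ell2 ?P \<and> (ell2_norm ?P (?S W f))\<^sup>2 \<le> B" if "finite W" for W
    using that
  proof (induction W rule: finite_induct)
    case empty
    show ?case by (rule exI[of _ 0]) (auto simp: ell2_def ell2_norm_def)
  next
    case (insert w W)
    then obtain B where B: "\<And>f. f \<in> ell2 ?P \<Longrightarrow> ell2_norm ?P f \<le> 1 \<Longrightarrow>
        ?S W f \<in> ell2 ?P \<and> (ell2_norm ?P (?S W f))\<^sup>2 \<le> B" by blast
    let ?c = "Poly_Mapping.lookup p w"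
    show ?case
    proof (intro exI[of _ "2 * (cmod ?c)\<^sup>2 + 2 * B"] ballI impI)
      fix f assume f: "f \<in> ell2 ?P" "ell2_norm ?P f \<le> 1"
      have m: "foldr ?T w f \<in> ell2 ?P" "ell2_norm ?P (foldr ?T w f) \<le> 1"
        using foldr_creation_bounded[OF f(1), of ed w] f(2) by auto
      have eq: "?S (insert w W) f = (\<lambda>u. ?c * foldr ?T w f u + ?S W f u)"
        using insert.hyps by simp
      have "0 \<le> ell2_norm ?P (foldr ?T w f)" by (simp add: ell2_norm_def infsum_nonneg)
      then have "(ell2_norm ?P (foldr ?T w f))\<^sup>2 \<le> 1" using m(2) by (simp add: power_le_one)
      then have "2 * (cmod ?c)\<^sup>2 * (ell2_norm ?P (foldr ?T w f))\<^sup>2 \<le> 2 * (cmod ?c)\<^sup>2"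
        by (simp add: mult_left_le)
      then have "(ell2_norm ?P (?S (insert w W) f))\<^sup>2 \<le> 2 * (cmod ?c)\<^sup>2 + 2 * B"
        unfolding eq
        using ell2_lincomb_bounded(2)[OF m(1), of "?S W f" ?c] B[OF f] by linarith
      moreover have "?S (insert w W) f \<in> ell2 ?P"
        unfolding eq using ell2_lincomb_bounded(1)[OF m(1), of "?S W f" ?c] B[OF f] by blast
      ultimately show "?S (insert w W) f \<in> ell2 ?P \<and>
          (ell2_norm ?P (?S (insert w W) f))\<^sup>2 \<le> 2 * (cmod ?c)\<^sup>2 + 2 * B" by blast
    qed
  qed
  from this[OF finite_keys[of p]] obtain B where B: "\<And>f. f \<in> ell2 ?P \<Longrightarrow> ell2_norm ?P f \<le> 1 \<Longrightarrow>
      (ell2_norm ?P (nc_eval p ?T f))\<^sup>2 \<le> B"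
    unfolding nc_eval_def by blast
  then show ?thesis
    by (intro bdd_aboveI2[where M = "sqrt B"]) (auto intro: real_le_rsqrt)
qed

end

theory Submission
  imports Defs
begin

text \<open>Both inequalities are instances of one principle: if a homomorphism of directed graphs
  \<open>G \<rightarrow> H\<close> is injective on edges, then \<open>\<parallel>p(L\<^sub>G)\<parallel> \<le> \<parallel>p(L\<^sub>H)\<parallel>\<close>. An identification of vertices is such
  a homomorphism, and so is the map that collapses all vertices of a graph with \<open>n\<close> edges to
  the single vertex of \<open>C\<^sub>n\<close> and sends each edge to its number.

  The principle holds for the following reason. A creation operator extends a path at its range
  and therefore keeps its source, so \<open>\<H>\<^sub>G\<close> is the orthogonal sum, over the vertices \<open>v\<close>, of the
  reducing subspaces spanned by the paths with source \<open>v\<close>, and \<open>\<parallel>p(L\<^sub>G)\<parallel>\<close> is the supremum of the norms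
  on these subspaces. A path with a known source is determined by its list of edges, so the
  homomorphism is injective on the paths with source \<open>v\<close> and embeds their span isometrically
  into \<open>\<H>\<^sub>H\<close>. The image is usually not invariant under the operators \<open>L\<^sub>e\<close> of \<open>H\<close>, since
  edges that do not compose in \<open>G\<close> may compose in \<open>H\<close>. It is invariant under their adjoints, though,
  because removing the last edge of a path of \<open>G\<close> leaves a path of \<open>G\<close>. Hence a product of operators
  \<open>L\<^sub>e\<close> of \<open>H\<close>, compressed to the image, is the corresponding product for \<open>G\<close>
  (lemma \<open>foldr_creation_compression\<close>). So \<open>p(L\<^sub>G)\<close> on each subspace is a compression of
  \<open>p(L\<^sub>H)\<close>, and a compression does not increase the norm.\<close>

section \<open>Polynomials in creation operators\<close>

lemma ell2_norm_power2: "(ell2_norm I f)\<^sup>2 = (\<Sum>\<^sub>\<infinity>i\<in>I. (cmod (f i))\<^sup>2)"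
  by (simp add: ell2_norm_def infsum_nonneg)

lemma ell2_norm_nonneg: "0 \<le> ell2_norm I f"
  by (simp add: ell2_norm_def infsum_nonneg)

lemma ell2_scale:
  assumes "f \<in> ell2 I"
  shows "(\<lambda>i. c * f i) \<in> ell2 I"
    and "ell2_norm I (\<lambda>i. c * f i) = cmod c * ell2_norm I f"
proof -
  show "(\<lambda>i. c * f i) \<in> ell2 I"
    using assms by (auto simp: ell2_def norm_mult power_mult_distrib intro: summable_on_cmult_right)
  show "ell2_norm I (\<lambda>i. c * f i) = cmod c * ell2_norm I f"
    by (simp add: ell2_norm_def norm_mult power_mult_distrib infsum_cmult_right'
        real_sqrt_mult)
qed

lemma nc_eval_creation_in_ell2:
  assumes "f \<in> ell2 (finite_paths G)"
  shows "nc_eval p (\<lambda>i. creation G (ed i)) f \<in> ell2 (finite_paths G)"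
proof -
  have "(\<lambda>u. \<Sum>w\<in>W. Poly_Mapping.lookup p w * foldr (\<lambda>i. creation G (ed i)) w f u)
      \<in> ell2 (finite_paths G)" if "finite W" for W
    using that
  proof (induction W rule: finite_induct)
    case empty
    show ?case by (simp add: ell2_def)
  next
    case (insert w W)
    then show ?case
      using ell2_lincomb_bounded(1)[OF conjunct1[OF foldr_creation_bounded[OF assms]] insert.IH]
      by simp
  qed
  from this[OF finite_keys] show ?thesis unfolding nc_eval_def .
qed

lemma nc_eval_creation_scale:
  "nc_eval p (\<lambda>i. creation G (ed i)) (\<lambda>u. c * f u) = (\<lambda>u. c * nc_eval p (\<lambda>i. creation G (ed i)) f u)"
proof -
  have "foldr (\<lambda>i. creation G (ed i)) w (\<lambda>u. c * f u) = (\<lambda>u. c * foldr (\<lambda>i. creation G (ed i)) w f u)" for w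
    by (induction w) (auto simp: creation_def fun_eq_iff split: list.splits)
  then show ?thesis
    by (simp add: nc_eval_def sum_distrib_left mult.left_commute)
qed

lemma zero_in_ell2_unit_ball: "(\<lambda>_. 0) \<in> {f \<in> ell2 I. ell2_norm I f \<le> 1}"
  by (simp add: ell2_def ell2_norm_def)

lemma nc_eval_norm_le_in_unit_ball:
  assumes "f \<in> ell2 (finite_paths G)" and "ell2_norm (finite_paths G) f \<le> 1"
  shows "ell2_norm (finite_paths G) (nc_eval p (\<lambda>i. creation G (ed i)) f) \<le> poly_norm G ed p"
  unfolding poly_norm_def op_norm_def
  by (rule cSUP_upper[OF _ poly_norm_bdd_above]) (use assms in auto)

lemma poly_norm_nonneg: "0 \<le> poly_norm G ed p"
proof -
  have "ell2_norm (finite_paths G) (nc_eval p (\<lambda>i. creation G (ed i)) (\<lambda>_. 0)) \<le> poly_norm G ed p"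
    by (rule nc_eval_norm_le_in_unit_ball) (simp_all add: ell2_def ell2_norm_def)
  then show ?thesis by (rule order_trans[OF ell2_norm_nonneg])
qed

lemma nc_eval_norm_le:
  assumes f: "f \<in> ell2 (finite_paths G)"
  shows "ell2_norm (finite_paths G) (nc_eval p (\<lambda>i. creation G (ed i)) f)
    \<le> poly_norm G ed p * ell2_norm (finite_paths G) f"
proof (cases "ell2_norm (finite_paths G) f = 0")
  case True
  have sum: "(\<lambda>i. (cmod (f i))\<^sup>2) summable_on finite_paths G"
    and off: "\<And>i. i \<notin> finite_paths G \<Longrightarrow> f i = 0"
    using f unfolding ell2_def by blast+
  have inf: "infsum (\<lambda>i. (cmod (f i))\<^sup>2) (finite_paths G) \<le> 0"
    using True by (simp flip: ell2_norm_power2)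
  have "f i = 0" if "i \<in> finite_paths G" for i
    using nonneg_infsum_le_0D[OF inf sum _ that] by simp
  then have "f = (\<lambda>u. 0 * f u)" using off by (metis mult_zero_left)
  then have "nc_eval p (\<lambda>i. creation G (ed i)) f = (\<lambda>u. 0)"
    using nc_eval_creation_scale[of p G ed 0 f] by simp
  then show ?thesis using True by (simp add: ell2_norm_def)
next
  case False
  let ?r = "ell2_norm (finite_paths G) f"
  let ?c = "complex_of_real (1 / ?r)"
  have r: "?r > 0" using False ell2_norm_nonneg[of "finite_paths G" f] by linarith
  have "ell2_norm (finite_paths G) (nc_eval p (\<lambda>i. creation G (ed i)) (\<lambda>u. ?c * f u)) \<le> poly_norm G ed p"
    by (rule nc_eval_norm_le_in_unit_ball)
      (use r ell2_scale[OF f, of ?c] in \<open>simp_all add: norm_divide\<close>)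
  then show ?thesis
    using r unfolding nc_eval_creation_scale ell2_scale(2)[OF nc_eval_creation_in_ell2[OF f]]
    by (simp add: norm_divide field_simps)
qed

section \<open>Functions carried along an injection\<close>

definition extend_along :: "('a \<Rightarrow> 'b) \<Rightarrow> 'a set \<Rightarrow> ('a \<Rightarrow> complex) \<Rightarrow> 'b \<Rightarrow> complex" where
  "extend_along m B g u = (if u \<in> m ` B then g (inv_into B m u) else 0)"

lemma extend_along_apply:
  assumes "inj_on m B" and "x \<in> B"
  shows "extend_along m B g (m x) = g x"
  using assms by (simp add: extend_along_def inv_into_f_f)

lemma extend_along_isometry:
  assumes inj: "inj_on m B" and sub: "m ` B \<subseteq> I"
    and sum: "(\<lambda>x. (cmod (g x))\<^sup>2) summable_on B"
  shows "extend_along m B g \<in> ell2 I"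
    and "(ell2_norm I (extend_along m B g))\<^sup>2 = (\<Sum>\<^sub>\<infinity>x\<in>B. (cmod (g x))\<^sup>2)"
proof -
  let ?h = "\<lambda>u. (cmod (extend_along m B g u))\<^sup>2"
  have eq: "(?h \<circ> m) x = (cmod (g x))\<^sup>2" if "x \<in> B" for x
    using that inj by (simp add: extend_along_apply)
  have "(?h \<circ> m) summable_on B"
    by (rule iffD2[OF summable_on_cong sum]) (rule eq)
  then have "?h summable_on (m ` B)"
    by (simp add: summable_on_reindex[OF inj])
  moreover have "?h summable_on (m ` B) \<longleftrightarrow> ?h summable_on I"
    by (rule summable_on_cong_neutral) (use sub in \<open>auto simp: extend_along_def\<close>)
  ultimately show "extend_along m B g \<in> ell2 I"
    using sub by (auto simp: ell2_def extend_along_def)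
  have "infsum ?h I = infsum ?h (m ` B)"
    by (rule infsum_cong_neutral) (use sub in \<open>auto simp: extend_along_def\<close>)
  also have "\<dots> = infsum (?h \<circ> m) B" by (rule infsum_reindex[OF inj])
  also have "\<dots> = (\<Sum>\<^sub>\<infinity>x\<in>B. (cmod (g x))\<^sup>2)" by (rule infsum_cong[OF eq])
  finally show "(ell2_norm I (extend_along m B g))\<^sup>2 = (\<Sum>\<^sub>\<infinity>x\<in>B. (cmod (g x))\<^sup>2)"
    by (simp add: ell2_norm_power2)
qed

section \<open>Compression along a homomorphism of graphs\<close>

definition edge_injective_hom ::
  "('v \<Rightarrow> 'w) \<Rightarrow> ('e \<Rightarrow> 'f) \<Rightarrow> ('v, 'e) pre_digraph \<Rightarrow> ('w, 'f) pre_digraph \<Rightarrow> bool" where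
  "edge_injective_hom \<phi> \<eta> G H \<longleftrightarrow> \<phi> ` verts G \<subseteq> verts H \<and> \<eta> ` arcs G \<subseteq> arcs H \<and>
     inj_on \<eta> (arcs G) \<and>
     (\<forall>e\<in>arcs G. tail H (\<eta> e) = \<phi> (tail G e) \<and> head H (\<eta> e) = \<phi> (head G e))"

definition paths_from :: "('v, 'e) pre_digraph \<Rightarrow> 'v \<Rightarrow> 'e list set" where
  "paths_from G v = {es. (v, es) \<in> finite_paths G}"

definition map_path :: "('v \<Rightarrow> 'w) \<Rightarrow> ('e \<Rightarrow> 'f) \<Rightarrow> 'v \<Rightarrow> 'e list \<Rightarrow> ('w, 'f) path" where
  "map_path \<phi> \<eta> v es = (\<phi> v, map \<eta> es)"

lemma paths_from_Cons_iff:
  "e # es \<in> paths_from G v \<longleftrightarrow>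
     es \<in> paths_from G v \<and> e \<in> arcs G \<and> tail G e = path_range G (v, es)"
  using finite_paths_path_cons_iff[of e "(v, es)" G]
  by (simp add: paths_from_def path_cons_def path_source_def)

lemma paths_from_arcs: "es \<in> paths_from G v \<Longrightarrow> set es \<subseteq> arcs G"
  by (induction es) (auto simp: paths_from_Cons_iff)

text \<open>Fixing the source is essential: if \<open>\<phi>\<close> identifies two vertices, the empty paths at them
  have the same image.\<close>

lemma inj_on_map_path:
  assumes "edge_injective_hom \<phi> \<eta> G H"
  shows "inj_on (map_path \<phi> \<eta> v) (paths_from G v)"
proof (rule inj_onI)
  fix x y assume "x \<in> paths_from G v" "y \<in> paths_from G v" "map_path \<phi> \<eta> v x = map_path \<phi> \<eta> v y"
  then show "x = y"
    using assms paths_from_arcs[of x G v] paths_from_arcs[of y G v]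
    by (auto simp: map_path_def edge_injective_hom_def intro: map_inj_on inj_on_subset)
qed

lemma map_path_in_finite_paths:
  assumes hom: "edge_injective_hom \<phi> \<eta> G H" and "es \<in> paths_from G v"
  shows "map_path \<phi> \<eta> v es \<in> finite_paths H"
  using assms(2)
proof (induction es)
  case Nil
  then have "v \<in> verts G"
    by (auto simp: paths_from_def path_cons_def elim: finite_paths.cases)
  then show ?case
    using hom by (auto simp: map_path_def edge_injective_hom_def intro: finite_paths.vertex)
next
  case (Cons e es)
  then have es: "es \<in> paths_from G v" "e \<in> arcs G" "tail G e = path_range G (v, es)"
    by (auto simp: paths_from_Cons_iff)
  have "path_range H (map_path \<phi> \<eta> v es) = \<phi> (path_range G (v, es))"
    using hom paths_from_arcs[OF es(1)]
    by (auto simp: path_range_def map_path_def edge_injective_hom_def split: list.splits)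
  then have "path_cons (\<eta> e) (map_path \<phi> \<eta> v es) \<in> finite_paths H"
    using hom es Cons.IH by (intro finite_paths.edge) (auto simp: edge_injective_hom_def)
  then show ?case by (simp add: path_cons_def map_path_def path_source_def)
qed

text \<open>The right-hand side is the compression of a product of creation operators of \<open>H\<close> to the
  span of the images of the paths of \<open>G\<close> with source \<open>v\<close>. The value of \<open>L\<^sub>e f\<close> at a path
  depends only on the value of \<open>f\<close> at the path with its last edge removed. This path again lies in
  \<open>G\<close>, so evaluating the product at an image never involves a path outside the image.\<close>

lemma foldr_creation_compression:
  assumes hom: "edge_injective_hom \<phi> \<eta> G H" and ed: "ed ` set w \<subseteq> arcs G"
    and es: "es \<in> paths_from G v"
  shows "foldr (\<lambda>i. creation G (ed i)) w f (v, es) =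
    foldr (\<lambda>i. creation H (\<eta> (ed i))) w
      (extend_along (map_path \<phi> \<eta> v) (paths_from G v) (\<lambda>xs. f (v, xs))) (map_path \<phi> \<eta> v es)"
  using ed es
proof (induction w arbitrary: es)
  case Nil
  then show ?case by (simp add: extend_along_apply[OF inj_on_map_path[OF hom]])
next
  case (Cons i w)
  show ?case
  proof (cases es)
    case Nil
    then show ?thesis by (simp add: creation_def map_path_def)
  next
    case es: (Cons e xs)
    then have xs: "xs \<in> paths_from G v" "e \<in> arcs G"
      using Cons.prems(2) by (auto simp: paths_from_Cons_iff)
    have mem: "(v, e # xs) \<in> finite_paths G" "(\<phi> v, \<eta> e # map \<eta> xs) \<in> finite_paths H"
      using Cons.prems(2) map_path_in_finite_paths[OF hom Cons.prems(2)]
      by (auto simp: es paths_from_def map_path_def)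
    have "\<eta> e = \<eta> (ed i) \<longleftrightarrow> e = ed i"
      using hom xs(2) Cons.prems(1) by (auto simp: edge_injective_hom_def dest: inj_onD)
    then show ?thesis
      using mem Cons.IH[OF _ xs(1)] Cons.prems(1)
      by (simp add: es creation_def map_path_def path_source_def)
  qed
qed

text \<open>The squared norm of \<open>p(L\<^sub>G) f\<close> is the sum over the vertices \<open>v\<close> of the contributions of the
  paths with source \<open>v\<close>. Each of them is at most \<open>\<parallel>p(L\<^sub>H)\<parallel>\<^sup>2\<close> times the contribution of the same
  paths to the squared norm of \<open>f\<close>, by compression. Summing the squares over \<open>v\<close> keeps the
  constant, even when infinitely many vertices have the same image.\<close>

theorem poly_norm_le_of_edge_injective_hom:
  assumes hom: "edge_injective_hom \<phi> \<eta> G H"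
    and ed: "\<And>w i. w \<in> Poly_Mapping.keys p \<Longrightarrow> i \<in> set w \<Longrightarrow> ed i \<in> arcs G"
  shows "poly_norm G ed p \<le> poly_norm H (\<lambda>i. \<eta> (ed i)) p"
proof -
  let ?P = "finite_paths G"
  let ?B = "paths_from G"
  let ?TG = "nc_eval p (\<lambda>i. creation G (ed i))"
  let ?TH = "nc_eval p (\<lambda>i. creation H (\<eta> (ed i)))"
  let ?N = "poly_norm H (\<lambda>i. \<eta> (ed i)) p"
  have P: "?P = Sigma UNIV ?B" by (auto simp: paths_from_def)
  have "ell2_norm ?P (?TG f) \<le> ?N" if f: "f \<in> ell2 ?P" and f1: "ell2_norm ?P f \<le> 1" for f
  proof -
    let ?F = "\<lambda>v. extend_along (map_path \<phi> \<eta> v) (?B v) (\<lambda>xs. f (v, xs))"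
    let ?a = "\<lambda>v es. (cmod (?TG f (v, es)))\<^sup>2"
    let ?b = "\<lambda>v es. (cmod (f (v, es)))\<^sup>2"
    have sa: "(\<lambda>(v, es). ?a v es) summable_on Sigma UNIV ?B"
      using nc_eval_creation_in_ell2[OF f, of p ed] by (simp add: ell2_def case_prod_beta' flip: P)
    have sb: "(\<lambda>(v, es). ?b v es) summable_on Sigma UNIV ?B"
      using f by (simp add: ell2_def case_prod_beta' flip: P)
    have sav: "?a v summable_on ?B v" and sbv: "?b v summable_on ?B v" for v
      using summable_on_SigmaD1[OF sa, of v] summable_on_SigmaD1[OF sb, of v]
      by auto
    have fibre: "infsum (?a v) (?B v) \<le> ?N\<^sup>2 * infsum (?b v) (?B v)" for v
    proof -
      have sub: "map_path \<phi> \<eta> v ` ?B v \<subseteq> finite_paths H"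
        using map_path_in_finite_paths[OF hom] by blast
      note F = extend_along_isometry[OF inj_on_map_path[OF hom] sub sbv]
      let ?h = "\<lambda>u. (cmod (?TH (?F v) u))\<^sup>2"
      have sh: "?h summable_on finite_paths H"
        using nc_eval_creation_in_ell2[OF F(1)] by (simp add: ell2_def)
      have "?TG f (v, es) = ?TH (?F v) (map_path \<phi> \<eta> v es)" if "es \<in> ?B v" for es
        unfolding nc_eval_def
        by (rule sum.cong) (use that ed in \<open>auto intro!: foldr_creation_compression[OF hom]\<close>)
      then have "infsum (?a v) (?B v) = infsum (?h \<circ> map_path \<phi> \<eta> v) (?B v)"
        by (intro infsum_cong) simp
      also have "\<dots> = infsum ?h (map_path \<phi> \<eta> v ` ?B v)"
        by (rule infsum_reindex[OF inj_on_map_path[OF hom], symmetric])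
      also have "\<dots> \<le> infsum ?h (finite_paths H)"
        by (rule infsum_mono2[OF summable_on_subset_banach[OF sh sub] sh sub]) auto
      also have "\<dots> = (ell2_norm (finite_paths H) (?TH (?F v)))\<^sup>2"
        by (simp add: ell2_norm_power2)
      also have "\<dots> \<le> (?N * ell2_norm (finite_paths H) (?F v))\<^sup>2"
        by (intro power_mono nc_eval_norm_le F(1) ell2_norm_nonneg)
      also have "\<dots> = ?N\<^sup>2 * infsum (?b v) (?B v)"
        by (simp add: power_mult_distrib F(2))
      finally show ?thesis .
    qed
    have "(ell2_norm ?P (?TG f))\<^sup>2 = infsum (\<lambda>(v, es). ?a v es) (Sigma UNIV ?B)"
      unfolding ell2_norm_power2 P by (simp add: case_prod_beta')
    also have "\<dots> = (\<Sum>\<^sub>\<infinity>v. infsum (?a v) (?B v))"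
      by (rule infsum_Sigma'_banach[OF sa, symmetric])
    also have "\<dots> \<le> (\<Sum>\<^sub>\<infinity>v. ?N\<^sup>2 * infsum (?b v) (?B v))"
      by (intro infsum_mono summable_on_cmult_right fibre
          summable_on_Sigma_banach[OF sa] summable_on_Sigma_banach[OF sb])
    also have "\<dots> = ?N\<^sup>2 * infsum (\<lambda>(v, es). ?b v es) (Sigma UNIV ?B)"
      by (simp only: infsum_cmult_right' infsum_Sigma'_banach[OF sb])
    also have "\<dots> = (?N * ell2_norm ?P f)\<^sup>2"
      unfolding power_mult_distrib ell2_norm_power2 P by (simp add: case_prod_beta')
    finally have "ell2_norm ?P (?TG f) \<le> ?N * ell2_norm ?P f"
      by (rule power2_le_imp_le) (simp add: poly_norm_nonneg ell2_norm_nonneg)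
    also have "\<dots> \<le> ?N"
      using f1 poly_norm_nonneg by (rule mult_left_le)
    finally show ?thesis .
  qed
  then show ?thesis
    unfolding poly_norm_def[of G] op_norm_def
    by (intro cSUP_least) (use zero_in_ell2_unit_ball in auto)
qed

lemma deformation_le_hom:
  assumes "deformation_le G H"
  obtains \<phi> where "edge_injective_hom \<phi> id G H"
  using assms unfolding deformation_le_def edge_injective_hom_def by auto

lemma collapse_hom_loop_digraph:
  assumes "bij_betw ed {i. enat i < n} (arcs G)"
  shows "edge_injective_hom (\<lambda>_. ()) (inv_into {i. enat i < n} ed) G (loop_digraph n)"
  using bij_betw_inv_into[OF assms]
  by (auto simp: edge_injective_hom_def loop_digraph_def bij_betw_def)

theorem corollary5p3:
  fixes G1 :: "('v, 'e) pre_digraph" and G2 :: "('w, 'e) pre_digraph"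
    and n :: enat and ed :: "nat \<Rightarrow> 'e" and p :: "nat list \<Rightarrow>\<^sub>0 complex"
  assumes "n \<ge> 1"
    and "countable_digraph G1" and "no_sinks G1"
    and "countable_digraph G2" and "no_sinks G2"
    and "bij_betw ed {i. enat i < n} (arcs G1)"
    and "deformation_le G1 G2"
    and "p \<in> nc_polynomials n"
  shows "poly_norm G1 ed p \<le> poly_norm G2 ed p
    \<and> poly_norm G2 ed p \<le> poly_norm (loop_digraph n) id p"
proof
  let ?I = "{i. enat i < n}"
  have arcs: "arcs G2 = arcs G1" using assms(7) by (simp add: deformation_le_def)
  have var: "i \<in> ?I" if "w \<in> Poly_Mapping.keys p" "i \<in> set w" for w i
    using assms(8) that by (auto simp: nc_polynomials_def)
  then have ed: "ed i \<in> arcs G1" if "w \<in> Poly_Mapping.keys p" "i \<in> set w" for w i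
    using assms(6) that by (auto simp: bij_betw_def)
  obtain \<phi> where "edge_injective_hom \<phi> id G1 G2" using deformation_le_hom[OF assms(7)] .
  from poly_norm_le_of_edge_injective_hom[OF this ed]
  show "poly_norm G1 ed p \<le> poly_norm G2 ed p" by simp
  let ?\<eta> = "inv_into ?I ed"
  have "poly_norm G2 ed p \<le> poly_norm (loop_digraph n) (\<lambda>i. ?\<eta> (ed i)) p"
    by (rule poly_norm_le_of_edge_injective_hom[OF collapse_hom_loop_digraph])
      (use assms(6) ed arcs in auto)
  also have "\<dots> = poly_norm (loop_digraph n) id p"
  proof -
    (* ?\<eta> (ed i) = i only for the variables i < n, but no others occur in p. *)
    have "foldr (\<lambda>i. creation (loop_digraph n) (?\<eta> (ed i))) w =
        foldr (\<lambda>i. creation (loop_digraph n) (id i)) w" if "w \<in> Poly_Mapping.keys p" for w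
      using assms(6) var[OF that] by (intro ext foldr_cong) (auto simp: bij_betw_def)
    then have "nc_eval p (\<lambda>i. creation (loop_digraph n) (?\<eta> (ed i))) =
        nc_eval p (\<lambda>i. creation (loop_digraph n) (id i))"
      unfolding nc_eval_def by (intro ext sum.cong) simp_all
    then show ?thesis by (simp only: poly_norm_def)
  qed
  finally show "poly_norm G2 ed p \<le> poly_norm (loop_digraph n) id p" .
qed

end
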